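(* Let $G$ be a large scale group of bounded geometry that is not locally bounded and is $\sigma$-bounded. If $G$ has exactly two ends, then $G$ contains an infinite cyclic subgroup of bounded index.
   Context: A large scale group is a group $G$ with a bornology $\mathcal B$ (a cover closed under subsets and finite unions) closed under inverses and products; uniformly bounded covers are those refining $\{gB\}_{g\in G}$ for some $B\in\mathcal B$; bounded sets are members of $\mathcal B$. $G$ has bounded geometry if it is coarsely equivalent to a large scale space $Y$ in which every uniformly bounded cover $\mathcal U$ has a bound $N(\mathcal U)$ on the cardinality of its elements (equivalently, there is a bounded $K\subseteq G$ such that every bounded set is covered by finitely many translates $gK$). $G$ is locally bounded if $\langle B\rangle$ is bounded for every bounded $B$. $G$ is $\sigma$-bounded if it is the union of countably many bounded subsets. A subgroup $H$ has bounded index if $B\cdot H=G$ for some bounded $B$. For $A\subseteq G$ and a cover $\mathcal U$, $st(A,\mathcal U)$ is the union of members of $\mathcal U$ meeting $A$; $A$ is coarsely clopen if $st(A,\mathcal U)\cap st(G\setminus A,\mathcal U)$ is bounded for each uniformly bounded $\mathcal U$. An end is a family of unbounded coarsely clopen sets maximal with respect to all finite intersections being unbounded. *)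

theory Defs
  imports "HOL-Algebra.Coset" "HOL-Algebra.Generated_Groups"
begin

definition bornology :: "'a set \<Rightarrow> 'a set set \<Rightarrow> bool" where
  "bornology X \<B> \<longleftrightarrow> (\<forall>A\<in>\<B>. A \<subseteq> X) \<and> \<Union>\<B> = X
     \<and> (\<forall>A\<in>\<B>. \<forall>C. C \<subseteq> A \<longrightarrow> C \<in> \<B>)
     \<and> (\<forall>A\<in>\<B>. \<forall>C\<in>\<B>. A \<union> C \<in> \<B>)"

definition large_scale_group :: "('a, 'b) monoid_scheme \<Rightarrow> 'a set set \<Rightarrow> bool" where
  "large_scale_group G \<B> \<longleftrightarrow> group G \<and> bornology (carrier G) \<B>
     \<and> (\<forall>A\<in>\<B>. set_inv\<^bsub>G\<^esub> A \<in> \<B>)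
     \<and> (\<forall>A\<in>\<B>. \<forall>C\<in>\<B>. A <#>\<^bsub>G\<^esub> C \<in> \<B>)"

definition unif_bdd_cover :: "('a, 'b) monoid_scheme \<Rightarrow> 'a set set \<Rightarrow> 'a set set \<Rightarrow> bool" where
  "unif_bdd_cover G \<B> \<U> \<longleftrightarrow> \<Union>\<U> = carrier G
     \<and> (\<exists>B\<in>\<B>. \<forall>U\<in>\<U>. \<exists>g\<in>carrier G. U \<subseteq> g <#\<^bsub>G\<^esub> B)"

definition star :: "'a set \<Rightarrow> 'a set set \<Rightarrow> 'a set" where
  "star A \<U> = \<Union>{U\<in>\<U>. U \<inter> A \<noteq> {}}"

definition coarsely_clopen :: "('a, 'b) monoid_scheme \<Rightarrow> 'a set set \<Rightarrow> 'a set \<Rightarrow> bool" where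
  "coarsely_clopen G \<B> A \<longleftrightarrow> A \<subseteq> carrier G \<and>
     (\<forall>\<U>. unif_bdd_cover G \<B> \<U> \<longrightarrow> star A \<U> \<inter> star (carrier G - A) \<U> \<in> \<B>)"

definition unbdd_fip_family :: "('a, 'b) monoid_scheme \<Rightarrow> 'a set set \<Rightarrow> 'a set set \<Rightarrow> bool" where
  "unbdd_fip_family G \<B> \<E> \<longleftrightarrow>
     (\<forall>A\<in>\<E>. coarsely_clopen G \<B> A \<and> A \<notin> \<B>)
     \<and> (\<forall>F. finite F \<and> F \<noteq> {} \<and> F \<subseteq> \<E> \<longrightarrow> \<Inter>F \<notin> \<B>)"

definition is_end :: "('a, 'b) monoid_scheme \<Rightarrow> 'a set set \<Rightarrow> 'a set set \<Rightarrow> bool" where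
  "is_end G \<B> \<E> \<longleftrightarrow> \<E> \<noteq> {} \<and> unbdd_fip_family G \<B> \<E>
     \<and> (\<forall>\<E>'. \<E> \<subseteq> \<E>' \<and> unbdd_fip_family G \<B> \<E>' \<longrightarrow> \<E>' = \<E>)"

definition ends :: "('a, 'b) monoid_scheme \<Rightarrow> 'a set set \<Rightarrow> 'a set set set" where
  "ends G \<B> = {\<E>. is_end G \<B> \<E>}"

text \<open>Bounded geometry (group characterization): some bounded K such that every
  bounded set is covered by finitely many left translates gK.\<close>
definition bounded_geometry :: "('a, 'b) monoid_scheme \<Rightarrow> 'a set set \<Rightarrow> bool" where
  "bounded_geometry G \<B> \<longleftrightarrow> (\<exists>K\<in>\<B>. \<forall>B\<in>\<B>. \<exists>F. finite F \<and> F \<subseteq> carrier G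
     \<and> B \<subseteq> (\<Union>g\<in>F. g <#\<^bsub>G\<^esub> K))"

definition locally_bounded :: "('a, 'b) monoid_scheme \<Rightarrow> 'a set set \<Rightarrow> bool" where
  "locally_bounded G \<B> \<longleftrightarrow> (\<forall>B\<in>\<B>. generate G B \<in> \<B>)"

definition sigma_bounded :: "('a, 'b) monoid_scheme \<Rightarrow> 'a set set \<Rightarrow> bool" where
  "sigma_bounded G \<B> \<longleftrightarrow> (\<exists>f :: nat \<Rightarrow> 'a set. range f \<subseteq> \<B> \<and> (\<Union>n. f n) = carrier G)"

definition bounded_index :: "('a, 'b) monoid_scheme \<Rightarrow> 'a set set \<Rightarrow> 'a set \<Rightarrow> bool" where
  "bounded_index G \<B> H \<longleftrightarrow> (\<exists>B\<in>\<B>. B <#>\<^bsub>G\<^esub> H = carrier G)"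

end

theory Submission
  imports Defs
begin

text \<open>Since there are only two ends, no three unbounded coarsely clopen sets are pairwise
  disjoint. So there is a coarsely clopen set A, unbounded with unbounded complement, such that
  every left translate gA differs by a bounded set from A or from its complement. This forces G
  to be generated by a bounded set S. Enclose the S-boundary of A in a bounded connected set D.
  Some g with gA close to A moves D off itself; connectedness then makes gA and A nested, so
  that h = g or its inverse satisfies hA \<subset> A. The sets A - hA and its translates by powers of
  h cover G, hence the powers of h have bounded index.\<close>

text \<open>Right multiplication by \<open>S\<close> gives a graph on which left translations act by
  automorphisms, and only in a connected graph does an empty boundary make a set trivial; hence the
  need for generators. Failure of local boundedness supplies a bounded set generating an unbounded
  subgroup. A coset of it that misses the boundary of \<open>A\<close> lies on one side of the cut,
  and translating back to the subgroup leads to a contradiction. The obstacle is that a bounded set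
  may be infinite, and that new generators can enlarge the boundary. Bounded geometry gives one
  \<open>K\<close>, fixed in advance, such that every bounded set lies in finitely many cosets
  \<open>g <# K\<close>. Once \<open>K\<close> is among the generators, finitely many centres decide
  whether a boundary lies in the generated subgroup, or in one ball. Such a ball serves as
  \<open>D\<close>: the boundary alone may be disconnected, and a translate of it could then have
  parts on both sides of the cut.\<close>

locale ls_group = group G for G (structure) +
  fixes \<B> :: "'a set set"
  assumes large_scale: "large_scale_group G \<B>"
begin

section \<open>Bounded sets and products of sets\<close>

lemma bounded_subset: "B \<in> \<B> \<Longrightarrow> C \<subseteq> B \<Longrightarrow> C \<in> \<B>"
  using large_scale unfolding large_scale_group_def bornology_def by blast

lemma bounded_Un: "B \<in> \<B> \<Longrightarrow> C \<in> \<B> \<Longrightarrow> B \<union> C \<in> \<B>"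
  using large_scale unfolding large_scale_group_def bornology_def by blast

lemma bounded_mult: "B \<in> \<B> \<Longrightarrow> C \<in> \<B> \<Longrightarrow> B <#> C \<in> \<B>"
  using large_scale unfolding large_scale_group_def by blast

lemma bounded_inv: "B \<in> \<B> \<Longrightarrow> set_inv B \<in> \<B>"
  using large_scale unfolding large_scale_group_def by blast

lemma bounded_carrier: "B \<in> \<B> \<Longrightarrow> B \<subseteq> carrier G"
  using large_scale unfolding large_scale_group_def bornology_def by blast

lemma bounded_singleton: "x \<in> carrier G \<Longrightarrow> {x} \<in> \<B>"
proof -
  assume "x \<in> carrier G"
  then obtain B where "B \<in> \<B>" "x \<in> B"
    using large_scale unfolding large_scale_group_def bornology_def by blast
  then show ?thesis using bounded_subset by blast
qed

lemma bounded_empty: "{} \<in> \<B>"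
  using bounded_singleton[OF one_closed] bounded_subset by blast

lemma bounded_finite: "finite F \<Longrightarrow> F \<subseteq> carrier G \<Longrightarrow> F \<in> \<B>"
proof (induction F rule: finite_induct)
  case empty
  show ?case by (rule bounded_empty)
next
  case (insert x F)
  then show ?case using bounded_Un[OF bounded_singleton[of x], of F] by simp
qed

lemma mem_set_mult: "x \<in> A \<Longrightarrow> y \<in> B \<Longrightarrow> x \<otimes> y \<in> A <#> B"
  unfolding set_mult_def by blast

lemma mem_set_inv: "x \<in> A \<Longrightarrow> inv x \<in> set_inv A"
  unfolding SET_INV_def by blast

lemma set_multE:
  assumes "z \<in> A <#> B"
  obtains x y where "x \<in> A" "y \<in> B" "z = x \<otimes> y"
  using assms unfolding set_mult_def by blast

section \<open>Left translation of sets\<close>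

text \<open>A preimage instead of the coset \<open>g <# A\<close>, which it equals for
  \<open>g\<close> and \<open>A\<close> in the carrier; Boolean operations then commute with it by
  unfolding.\<close>

definition translate :: "'a \<Rightarrow> 'a set \<Rightarrow> 'a set" where
  "translate g A = {x \<in> carrier G. inv g \<otimes> x \<in> A}"

lemma translate_carrier: "translate g A \<subseteq> carrier G"
  by (auto simp: translate_def)

lemma translate_translate:
  "g \<in> carrier G \<Longrightarrow> h \<in> carrier G \<Longrightarrow> translate g (translate h A) = translate (g \<otimes> h) A"
  by (auto simp: translate_def inv_mult_group m_assoc)

lemma translate_one: "A \<subseteq> carrier G \<Longrightarrow> translate \<one> A = A"
  by (auto simp: translate_def)

lemma translate_inv_cancel:
  "g \<in> carrier G \<Longrightarrow> A \<subseteq> carrier G \<Longrightarrow> translate (inv g) (translate g A) = A"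
  by (simp add: translate_translate translate_one)

lemma translate_cancel_inv:
  "g \<in> carrier G \<Longrightarrow> A \<subseteq> carrier G \<Longrightarrow> translate g (translate (inv g) A) = A"
  by (simp add: translate_translate translate_one)

lemma translate_Diff: "translate g (A - C) = translate g A - translate g C"
  by (auto simp: translate_def)

lemma translate_Un: "translate g (A \<union> C) = translate g A \<union> translate g C"
  by (auto simp: translate_def)

lemma translate_Int: "translate g (A \<inter> C) = translate g A \<inter> translate g C"
  by (auto simp: translate_def)

lemma translate_univ: "g \<in> carrier G \<Longrightarrow> translate g (carrier G) = carrier G"
  by (auto simp: translate_def)

lemma translate_compl:
  "g \<in> carrier G \<Longrightarrow> translate g (carrier G - A) = carrier G - translate g A"
  by (simp add: translate_Diff translate_univ)

lemma translate_mono: "A \<subseteq> C \<Longrightarrow> translate g A \<subseteq> translate g C"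
  by (auto simp: translate_def)

lemma translate_empty: "translate g {} = {}"
  by (auto simp: translate_def)

lemma bounded_translate:
  assumes "g \<in> carrier G" "B \<in> \<B>"
  shows "translate g B \<in> \<B>"
proof -
  have "translate g B \<subseteq> {g} <#> B"
  proof
    fix x assume x: "x \<in> translate g B"
    then have "g \<otimes> (inv g \<otimes> x) = x"
      using assms by (simp add: translate_def m_assoc[symmetric])
    then show "x \<in> {g} <#> B" using x mem_set_mult[of g "{g}" "inv g \<otimes> x" B]
      by (auto simp: translate_def)
  qed
  then show ?thesis using bounded_subset bounded_mult bounded_singleton assms by blast
qed

lemma bounded_translate_iff:
  assumes "g \<in> carrier G" "B \<subseteq> carrier G"
  shows "translate g B \<in> \<B> \<longleftrightarrow> B \<in> \<B>"
  using bounded_translate[of g B] bounded_translate[of "inv g" "translate g B"] assms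
  by (auto simp: translate_inv_cancel)

section \<open>Equality up to bounded sets\<close>

definition near :: "'a set \<Rightarrow> 'a set \<Rightarrow> bool" where
  "near X Y \<longleftrightarrow> (X - Y) \<union> (Y - X) \<in> \<B>"

lemma near_sym: "near X Y \<Longrightarrow> near Y X"
  by (simp add: near_def Un_commute)

lemma near_trans:
  assumes "near X Y" "near Y Z"
  shows "near X Z"
proof -
  have "(X - Z) \<union> (Z - X) \<subseteq> ((X - Y) \<union> (Y - X)) \<union> ((Y - Z) \<union> (Z - Y))" by blast
  then show ?thesis using assms bounded_Un bounded_subset unfolding near_def by meson
qed

lemma near_compl:
  assumes "near X Y"
  shows "near (carrier G - X) (carrier G - Y)"
proof -
  have "((carrier G - X) - (carrier G - Y)) \<union> ((carrier G - Y) - (carrier G - X))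
    \<subseteq> (X - Y) \<union> (Y - X)" by blast
  then show ?thesis using assms bounded_subset unfolding near_def by meson
qed

lemma near_Int:
  assumes "near X Y"
  shows "near (L \<inter> X) (L \<inter> Y)"
proof -
  have "(L \<inter> X - L \<inter> Y) \<union> (L \<inter> Y - L \<inter> X) \<subseteq> (X - Y) \<union> (Y - X)" by blast
  then show ?thesis using assms bounded_subset unfolding near_def by meson
qed

lemma near_translate:
  assumes "g \<in> carrier G" "near X Y"
  shows "near (translate g X) (translate g Y)"
  using bounded_translate[OF assms(1) assms(2)[unfolded near_def]]
  unfolding near_def by (simp add: translate_Un translate_Diff)

lemma near_bounded:
  assumes "near X Y" "X \<in> \<B>"
  shows "Y \<in> \<B>"
proof -
  have "Y \<subseteq> X \<union> ((X - Y) \<union> (Y - X))" by blast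
  then show ?thesis using assms bounded_Un bounded_subset unfolding near_def by meson
qed

lemma near_disjoint:
  assumes "near X Y" "X \<inter> Y = {}"
  shows "X \<in> \<B>"
proof -
  have "X \<subseteq> (X - Y) \<union> (Y - X)" using assms(2) by blast
  then show ?thesis using assms(1) bounded_subset unfolding near_def by meson
qed

section \<open>Coarsely clopen sets\<close>

text \<open>Two points in one member of a uniformly bounded cover differ by a right factor from a
  fixed bounded set, so covers can be traded for right multiplication. Testing outside
  \<open>A\<close> suffices: points of both stars, even those inside \<open>A\<close>, are reached
  from there by one more bounded factor.\<close>

lemma coarsely_clopen_iff:
  "coarsely_clopen G \<B> A \<longleftrightarrow>
    A \<subseteq> carrier G \<and> (\<forall>B\<in>\<B>. (A <#> B) \<inter> (carrier G - A) \<in> \<B>)"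
proof (intro iffI conjI ballI)
  assume cc: "coarsely_clopen G \<B> A"
  then show sub: "A \<subseteq> carrier G" by (simp add: coarsely_clopen_def)
  fix B assume B: "B \<in> \<B>"
  \<comment> \<open>Adding \<open>\<one>\<close> puts every \<open>g\<close> into its own coset, so
    the cosets cover the carrier.\<close>
  define B' where "B' = B \<union> {\<one>}"
  define U where "U = {g <# B' | g. g \<in> carrier G}"
  have B': "B' \<in> \<B>" unfolding B'_def using B bounded_Un bounded_singleton by blast
  have mem: "g \<in> g <# B'" if "g \<in> carrier G" for g
    using that unfolding l_coset_def B'_def by force
  have "\<Union>U = carrier G"
    using mem l_coset_subset_G[OF bounded_carrier[OF B']] unfolding U_def by blast
  then have "unif_bdd_cover G \<B> U"
    unfolding unif_bdd_cover_def using B' unfolding U_def by blast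
  then have *: "star A U \<inter> star (carrier G - A) U \<in> \<B>"
    using cc unfolding coarsely_clopen_def by blast
  have "(A <#> B) \<inter> (carrier G - A) \<subseteq> star A U \<inter> star (carrier G - A) U"
  proof
    fix y assume y: "y \<in> (A <#> B) \<inter> (carrier G - A)"
    then obtain a b where ab: "a \<in> A" "b \<in> B" "y = a \<otimes> b" by (auto elim: set_multE)
    have a: "a \<in> a <# B'" using ab(1) sub mem by blast
    moreover have "y \<in> a <# B'" using ab unfolding l_coset_def B'_def by blast
    moreover have "a <# B' \<in> U" using ab(1) sub unfolding U_def by blast
    ultimately show "y \<in> star A U \<inter> star (carrier G - A) U"
      using ab(1) y unfolding star_def by blast
  qed
  then show "(A <#> B) \<inter> (carrier G - A) \<in> \<B>" using * bounded_subset by blast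
next
  assume H: "A \<subseteq> carrier G \<and> (\<forall>B\<in>\<B>. (A <#> B) \<inter> (carrier G - A) \<in> \<B>)"
  show "coarsely_clopen G \<B> A" unfolding coarsely_clopen_def
  proof (intro conjI allI impI)
    show "A \<subseteq> carrier G" using H by blast
    fix U assume "unif_bdd_cover G \<B> U"
    then obtain B where B: "B \<in> \<B>" "\<And>V. V \<in> U \<Longrightarrow> \<exists>g\<in>carrier G. V \<subseteq> g <# B"
      and U: "\<Union>U = carrier G"
      unfolding unif_bdd_cover_def by blast
    define D where "D = set_inv B <#> B"
    have D: "D \<in> \<B>" unfolding D_def using B(1) bounded_inv bounded_mult by blast
    have close: "inv x \<otimes> y \<in> D" if xy: "x \<in> V" "y \<in> V" and V: "V \<in> U" for x y V
    proof -
      obtain g where g: "g \<in> carrier G" "V \<subseteq> g <# B" using B(2)[OF V] by blast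
      then obtain b c where bc: "b \<in> B" "c \<in> B" "x = g \<otimes> b" "y = g \<otimes> c"
        using xy unfolding l_coset_def by blast
      then have c: "b \<in> carrier G" "c \<in> carrier G" using bounded_carrier[OF B(1)] by auto
      have "inv x \<otimes> y = inv b \<otimes> c"
        using c g(1) by (simp add: bc inv_mult_group m_assoc) (simp add: m_assoc[symmetric])
      then show ?thesis unfolding D_def using bc mem_set_mult mem_set_inv by metis
    qed
    \<comment> \<open>The double factor is the way from \<open>a\<close> in \<open>A\<close> through
      the common point \<open>y\<close> to \<open>c\<close> outside \<open>A\<close>.\<close>
    define Z where "Z = (A <#> (D <#> D)) \<inter> (carrier G - A)"
    have Z: "Z \<in> \<B>" unfolding Z_def using H D bounded_mult by blast
    have "star A U \<inter> star (carrier G - A) U \<subseteq> Z <#> D"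
    proof
      fix y assume "y \<in> star A U \<inter> star (carrier G - A) U"
      then obtain V W a c where
        V: "V \<in> U" "y \<in> V" "a \<in> V" "a \<in> A" and W: "W \<in> U" "y \<in> W" "c \<in> W" "c \<in> carrier G - A"
        unfolding star_def by blast
      have car: "a \<in> carrier G" "y \<in> carrier G" "c \<in> carrier G" using V W U by auto
      have ay: "inv a \<otimes> y \<in> D" and yc: "inv y \<otimes> c \<in> D" and cy: "inv c \<otimes> y \<in> D"
        using close V W by blast+
      have "a \<otimes> ((inv a \<otimes> y) \<otimes> (inv y \<otimes> c)) = c"
        using car by (simp add: m_assoc[symmetric])
      then have "c \<in> Z" unfolding Z_def using W(4) V(4) ay yc mem_set_mult by (metis IntI)
      moreover have "c \<otimes> (inv c \<otimes> y) = y" using car by (simp add: m_assoc[symmetric])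
      ultimately show "y \<in> Z <#> D" using cy mem_set_mult by metis
    qed
    then show "star A U \<inter> star (carrier G - A) U \<in> \<B>"
      using Z D bounded_mult bounded_subset by blast
  qed
qed

lemma clopen_carrier: "coarsely_clopen G \<B> A \<Longrightarrow> A \<subseteq> carrier G"
  by (simp add: coarsely_clopen_def)

lemma clopen_compl:
  assumes "coarsely_clopen G \<B> A"
  shows "coarsely_clopen G \<B> (carrier G - A)"
proof -
  have "carrier G - (carrier G - A) = A" using clopen_carrier[OF assms] by blast
  then show ?thesis using assms unfolding coarsely_clopen_def
    by (simp add: Int_commute)
qed

lemma clopen_Int:
  assumes "coarsely_clopen G \<B> A" "coarsely_clopen G \<B> C"
  shows "coarsely_clopen G \<B> (A \<inter> C)"
  unfolding coarsely_clopen_iff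
proof (intro conjI ballI)
  show "A \<inter> C \<subseteq> carrier G" using clopen_carrier[OF assms(1)] by blast
  fix B assume B: "B \<in> \<B>"
  have "((A \<inter> C) <#> B) \<inter> (carrier G - (A \<inter> C))
     \<subseteq> ((A <#> B) \<inter> (carrier G - A)) \<union> ((C <#> B) \<inter> (carrier G - C))"
    unfolding set_mult_def by blast
  then show "((A \<inter> C) <#> B) \<inter> (carrier G - (A \<inter> C)) \<in> \<B>"
    using assms B unfolding coarsely_clopen_iff by (meson bounded_Un bounded_subset)
qed

lemma clopen_Inter:
  "finite F \<Longrightarrow> F \<noteq> {} \<Longrightarrow> (\<And>A. A \<in> F \<Longrightarrow> coarsely_clopen G \<B> A) \<Longrightarrow> coarsely_clopen G \<B> (\<Inter>F)"
  by (induction F rule: finite_ne_induct) (auto intro: clopen_Int)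

lemma clopen_translate:
  assumes "coarsely_clopen G \<B> A" and g: "g \<in> carrier G"
  shows "coarsely_clopen G \<B> (translate g A)"
  unfolding coarsely_clopen_iff
proof (intro conjI ballI translate_carrier)
  fix B assume B: "B \<in> \<B>"
  have "(translate g A <#> B) \<inter> (carrier G - translate g A)
     \<subseteq> translate g ((A <#> B) \<inter> (carrier G - A))"
  proof
    fix y assume y: "y \<in> (translate g A <#> B) \<inter> (carrier G - translate g A)"
    then obtain x b where xb: "x \<in> translate g A" "b \<in> B" "y = x \<otimes> b"
      by (auto elim: set_multE)
    have "b \<in> carrier G" "x \<in> carrier G" using xb bounded_carrier[OF B] translate_carrier by auto
    then have "inv g \<otimes> y = (inv g \<otimes> x) \<otimes> b" using xb(3) g by (simp add: m_assoc)
    then have "inv g \<otimes> y \<in> A <#> B" using xb mem_set_mult by (simp add: translate_def)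
    then show "y \<in> translate g ((A <#> B) \<inter> (carrier G - A))"
      using y g by (auto simp: translate_def)
  qed
  moreover have "translate g ((A <#> B) \<inter> (carrier G - A)) \<in> \<B>"
    using assms B bounded_translate unfolding coarsely_clopen_iff by blast
  ultimately show "(translate g A <#> B) \<inter> (carrier G - translate g A) \<in> \<B>"
    using bounded_subset by blast
qed

section \<open>Ends\<close>

text \<open>Zorn's lemma applies because a finite subset of the union of a chain lies in one member
  of the chain. Maximality among the families containing \<open>X\<close> is maximality outright,
  since a larger family still contains \<open>X\<close>.\<close>

lemma ex_end_containing:
  assumes "coarsely_clopen G \<B> X" "X \<notin> \<B>"
  shows "\<exists>E\<in>ends G \<B>. X \<in> E"
proof -
  let ?P = "{E. unbdd_fip_family G \<B> E \<and> X \<in> E}"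
  have "\<exists>M\<in>?P. \<forall>E\<in>?P. M \<subseteq> E \<longrightarrow> E = M"
  proof (rule subset_Zorn_nonempty)
    have "\<Inter>F \<notin> \<B>" if "F \<noteq> {}" "F \<subseteq> {X}" for F
      using subset_singletonD[OF that(2)] that(1) assms(2) by auto
    then have "unbdd_fip_family G \<B> {X}"
      using assms unfolding unbdd_fip_family_def by blast
    then show "?P \<noteq> {}" by blast
    fix \<C> assume ne: "\<C> \<noteq> {}" and ch: "subset.chain ?P \<C>"
    then have sub: "\<C> \<subseteq> ?P" by (simp add: subset.chain_def)
    have "\<Inter>F \<notin> \<B>" if F: "finite F" "F \<noteq> {}" "F \<subseteq> \<Union>\<C>" for F
    proof -
      obtain E where "E \<in> \<C>" "F \<subseteq> E"
        using finite_subset_Union_chain[OF F(1) F(3) ne ch] by blast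
      then show ?thesis using sub F unfolding unbdd_fip_family_def by blast
    qed
    then have "unbdd_fip_family G \<B> (\<Union>\<C>)"
      using sub unfolding unbdd_fip_family_def by blast
    then show "\<Union>\<C> \<in> ?P" using ne sub by blast
  qed
  then obtain M where "unbdd_fip_family G \<B> M" "X \<in> M"
    "\<And>E. unbdd_fip_family G \<B> E \<Longrightarrow> X \<in> E \<Longrightarrow> M \<subseteq> E \<Longrightarrow> E = M"
    by blast
  then show ?thesis unfolding ends_def is_end_def by blast
qed

lemma end_members_meet:
  assumes "E \<in> ends G \<B>" "X \<in> E" "Y \<in> E"
  shows "X \<inter> Y \<noteq> {}"
proof -
  have "unbdd_fip_family G \<B> E" using assms(1) by (simp add: ends_def is_end_def)
  moreover have "{X, Y} \<subseteq> E" using assms(2,3) by blast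
  moreover have "finite {X, Y} \<and> {X, Y} \<noteq> {}" by simp
  ultimately have "\<Inter>{X, Y} \<notin> \<B>" unfolding unbdd_fip_family_def by meson
  then show ?thesis using bounded_empty by auto
qed

text \<open>Members of one end meet, so three disjoint unbounded sets would require three different
  ends.\<close>

lemma no_three_disjoint_clopen:
  assumes "card (ends G \<B>) = 2"
    and "coarsely_clopen G \<B> X" "coarsely_clopen G \<B> Y" "coarsely_clopen G \<B> Z"
    and "X \<inter> Y = {}" "X \<inter> Z = {}" "Y \<inter> Z = {}"
  shows "X \<in> \<B> \<or> Y \<in> \<B> \<or> Z \<in> \<B>"
proof (rule ccontr)
  assume "\<not> ?thesis"
  then have u: "X \<notin> \<B>" "Y \<notin> \<B>" "Z \<notin> \<B>" by simp_all
  obtain E1 where E1: "E1 \<in> ends G \<B>" "X \<in> E1"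
    using ex_end_containing[OF assms(2) u(1)] by (elim bexE)
  obtain E2 where E2: "E2 \<in> ends G \<B>" "Y \<in> E2"
    using ex_end_containing[OF assms(3) u(2)] by (elim bexE)
  obtain E3 where E3: "E3 \<in> ends G \<B>" "Z \<in> E3"
    using ex_end_containing[OF assms(4) u(3)] by (elim bexE)
  have "E1 \<noteq> E2" "E1 \<noteq> E3" "E2 \<noteq> E3"
    using end_members_meet[OF E1] end_members_meet[OF E2] E2(2) E3(2) assms(5-7) by metis+
  then have "card {E1, E2, E3} = 3" by simp
  moreover have "finite (ends G \<B>)" using assms(1) card.infinite by fastforce
  moreover have "{E1, E2, E3} \<subseteq> ends G \<B>" using E1 E2 E3 by simp
  ultimately show False using card_mono[of "ends G \<B>" "{E1, E2, E3}"] assms(1) by simp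
qed

section \<open>Cuts\<close>

text \<open>The last clause is what later arguments retain of the number of ends: up to bounded
  sets, a translation preserves the two sides or exchanges them.\<close>

definition cut :: "'a set \<Rightarrow> bool" where
  "cut A \<longleftrightarrow> coarsely_clopen G \<B> A \<and> A \<notin> \<B> \<and> carrier G - A \<notin> \<B>
     \<and> (\<forall>g\<in>carrier G. near (translate g A) A \<or> near (translate g A) (carrier G - A))"

text \<open>\<open>A\<close> is taken from one end but not from the other. Maximality of the other
  end yields an unbounded intersection of its members that meets \<open>A\<close> in a bounded set
  only, so the complement of \<open>A\<close> is unbounded.\<close>

lemma ex_cut:
  assumes two: "card (ends G \<B>) = 2"
  shows "\<exists>A. cut A"
proof -
  obtain E1 E2 where E: "ends G \<B> = {E1, E2}" "E1 \<noteq> E2"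
    using two by (meson card_2_iff)
  then have e1: "is_end G \<B> E1" and e2: "is_end G \<B> E2" unfolding ends_def by blast+
  have "\<not> E1 \<subseteq> E2" using e1 e2 E(2) unfolding is_end_def by blast
  then obtain A where A: "A \<in> E1" "A \<notin> E2" by blast
  have cA: "coarsely_clopen G \<B> A" and uA: "A \<notin> \<B>"
    using A e1 unfolding is_end_def unbdd_fip_family_def by blast+
  have "\<not> unbdd_fip_family G \<B> (insert A E2)"
    using e2 A(2) unfolding is_end_def by blast
  moreover have f2: "unbdd_fip_family G \<B> E2" using e2 unfolding is_end_def by blast
  ultimately obtain F where F: "finite F" "F \<noteq> {}" "F \<subseteq> insert A E2" "\<Inter>F \<in> \<B>"
    using cA uA unfolding unbdd_fip_family_def by blast
  have ne: "F - {A} \<noteq> {}"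
  proof
    assume "F - {A} = {}"
    then have "F = {A}" using F(2) by blast
    then show False using F(4) uA by simp
  qed
  define C where "C = \<Inter>(F - {A})"
  have "finite (F - {A}) \<and> F - {A} \<noteq> {} \<and> F - {A} \<subseteq> E2" using F(1,3) ne by auto
  then have uC: "C \<notin> \<B>" using f2 unfolding C_def unbdd_fip_family_def by meson
  have "coarsely_clopen G \<B> C" unfolding C_def
    using F ne f2 by (intro clopen_Inter) (auto simp: unbdd_fip_family_def)
  then have "C \<subseteq> (carrier G - A) \<union> \<Inter>F"
    using clopen_carrier[of C] unfolding C_def by blast
  then have uA': "carrier G - A \<notin> \<B>" using uC F(4) bounded_Un bounded_subset by blast
  have "near (translate g A) A \<or> near (translate g A) (carrier G - A)"
    if g: "g \<in> carrier G" for g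
  proof -
    let ?C = "translate g A"
    have subA: "A \<subseteq> carrier G" using cA by (rule clopen_carrier)
    have cC: "coarsely_clopen G \<B> ?C" using clopen_translate cA g by blast
    have uC: "?C \<notin> \<B>" using uA g subA by (simp add: bounded_translate_iff)
    have uC': "carrier G - ?C \<notin> \<B>"
      using uA' g bounded_translate_iff[of g "carrier G - A"] by (simp add: translate_compl)
    let ?A' = "carrier G - A" and ?C' = "carrier G - ?C"
    \<comment> \<open>The two sets and their complements form a 2 by 2 table of intersections. Every
      row and column has an unbounded entry (\<open>u\<close>), but among any three entries one is
      bounded (\<open>t\<close>), so the unbounded entries are exactly those of one
      diagonal.\<close>
    have c: "coarsely_clopen G \<B> (A \<inter> ?C)" "coarsely_clopen G \<B> (A \<inter> ?C')"
      "coarsely_clopen G \<B> (?A' \<inter> ?C)" "coarsely_clopen G \<B> (?A' \<inter> ?C')"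
      using cA cC clopen_compl clopen_Int by blast+
    have s: "A \<subseteq> (A \<inter> ?C) \<union> (A \<inter> ?C')" "?A' \<subseteq> (?A' \<inter> ?C) \<union> (?A' \<inter> ?C')"
      "?C \<subseteq> (A \<inter> ?C) \<union> (?A' \<inter> ?C)" "?C' \<subseteq> (A \<inter> ?C') \<union> (?A' \<inter> ?C')"
      using subA translate_carrier[of g A] by blast+
    have u: "A \<inter> ?C \<notin> \<B> \<or> A \<inter> ?C' \<notin> \<B>" "?A' \<inter> ?C \<notin> \<B> \<or> ?A' \<inter> ?C' \<notin> \<B>"
      "A \<inter> ?C \<notin> \<B> \<or> ?A' \<inter> ?C \<notin> \<B>" "A \<inter> ?C' \<notin> \<B> \<or> ?A' \<inter> ?C' \<notin> \<B>"
      using uA uA' uC uC' s bounded_Un bounded_subset by meson+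
    have t: "A \<inter> ?C \<in> \<B> \<or> A \<inter> ?C' \<in> \<B> \<or> ?A' \<inter> ?C \<in> \<B>"
      "A \<inter> ?C \<in> \<B> \<or> A \<inter> ?C' \<in> \<B> \<or> ?A' \<inter> ?C' \<in> \<B>"
      "A \<inter> ?C \<in> \<B> \<or> ?A' \<inter> ?C \<in> \<B> \<or> ?A' \<inter> ?C' \<in> \<B>"
      "A \<inter> ?C' \<in> \<B> \<or> ?A' \<inter> ?C \<in> \<B> \<or> ?A' \<inter> ?C' \<in> \<B>"
      by (rule no_three_disjoint_clopen[OF two]; use c in blast)+
    have "(A \<inter> ?C' \<in> \<B> \<and> ?A' \<inter> ?C \<in> \<B>) \<or> (A \<inter> ?C \<in> \<B> \<and> ?A' \<inter> ?C' \<in> \<B>)"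
      using u t by blast
    moreover have "(?C - A) \<union> (A - ?C) \<subseteq> (A \<inter> ?C') \<union> (?A' \<inter> ?C)"
      "(?C - ?A') \<union> (?A' - ?C) \<subseteq> (A \<inter> ?C) \<union> (?A' \<inter> ?C')"
      using subA translate_carrier[of g A] by blast+
    ultimately show ?thesis unfolding near_def by (meson bounded_Un bounded_subset)
  qed
  then show ?thesis unfolding cut_def using cA uA uA' by blast
qed

lemma cut_carrier: "cut A \<Longrightarrow> A \<subseteq> carrier G"
  unfolding cut_def using clopen_carrier by blast

lemma cut_compl:
  assumes "cut A"
  shows "cut (carrier G - A)"
proof -
  have "carrier G - (carrier G - A) = A" using cut_carrier[OF assms] by blast
  then show ?thesis
    using assms clopen_compl near_compl[of "translate _ A"] unfolding cut_def
    by (fastforce simp: translate_compl)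
qed

section \<open>Boundaries in the Cayley graph\<close>

text \<open>The starting points of those edges of the Cayley graph, from \<open>x\<close> to
  \<open>x \<otimes> s\<close>, that cross between \<open>P\<close> and its complement in either
  direction.\<close>

definition boundary :: "'a set \<Rightarrow> 'a set \<Rightarrow> 'a set" where
  "boundary S P = {x \<in> carrier G. \<exists>s\<in>S. (x \<in> P) \<noteq> (x \<otimes> s \<in> P)}"

lemma boundary_translate:
  assumes "g \<in> carrier G" "S \<subseteq> carrier G"
  shows "boundary S (translate g P) = translate g (boundary S P)"
proof -
  have "inv g \<otimes> (x \<otimes> s) = (inv g \<otimes> x) \<otimes> s" if "x \<in> carrier G" "s \<in> S" for x s
    using that assms by (auto simp: m_assoc subset_iff)
  then show ?thesis using assms by (auto simp: boundary_def translate_def subset_iff)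
qed

lemma boundary_compl:
  "S \<subseteq> carrier G \<Longrightarrow> boundary S (carrier G - P) = boundary S P"
  by (auto simp: boundary_def)

text \<open>A crossing edge that starts in \<open>P\<close> ends in \<open>Z\<close>, so its start
  is found by stepping back from \<open>Z\<close>; one that starts outside \<open>P\<close> starts
  in \<open>P <#> set_inv S\<close>.\<close>

lemma bounded_boundary:
  assumes "coarsely_clopen G \<B> P" "S \<in> \<B>"
  shows "boundary S P \<in> \<B>"
proof -
  let ?T = "set_inv S"
  have T: "?T \<in> \<B>" using assms(2) by (rule bounded_inv)
  define Z where "Z = (P <#> S) \<inter> (carrier G - P)"
  have "boundary S P \<subseteq> (Z <#> ?T) \<union> ((P <#> ?T) \<inter> (carrier G - P))"
  proof
    fix x assume "x \<in> boundary S P"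
    then obtain s where s: "x \<in> carrier G" "s \<in> S" "(x \<in> P) \<noteq> (x \<otimes> s \<in> P)"
      unfolding boundary_def by blast
    have sc: "s \<in> carrier G" using s bounded_carrier assms(2) by blast
    then have x: "(x \<otimes> s) \<otimes> inv s = x" using s by (simp add: m_assoc)
    show "x \<in> (Z <#> ?T) \<union> ((P <#> ?T) \<inter> (carrier G - P))"
    proof (cases "x \<in> P")
      case True
      then have "x \<otimes> s \<in> Z" unfolding Z_def using s sc mem_set_mult by auto
      then show ?thesis using mem_set_mult mem_set_inv s(2) x by (metis UnI1)
    next
      case False
      then have "x \<in> P <#> ?T" using mem_set_mult mem_set_inv s(2,3) x by metis
      then show ?thesis using False s(1) by blast
    qed
  qed
  moreover have "(Z <#> ?T) \<union> ((P <#> ?T) \<inter> (carrier G - P)) \<in> \<B>"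
    using assms T unfolding coarsely_clopen_iff Z_def by (intro bounded_Un bounded_mult) blast+
  ultimately show ?thesis using bounded_subset by blast
qed

text \<open>A word in the generators is a path from \<open>x\<close> to \<open>x \<otimes> l\<close>
  inside the coset of \<open>x\<close>, where no edge crosses. The point \<open>x\<close> stays
  arbitrary in the induction because for a product the second half of the path starts at
  \<open>x \<otimes> h1\<close>.\<close>

lemma constant_off_boundary:
  assumes S: "S \<subseteq> carrier G"
    and l: "l \<in> generate G S"
  shows "x \<in> carrier G \<Longrightarrow> (\<And>l'. l' \<in> generate G S \<Longrightarrow> x \<otimes> l' \<notin> boundary S P)
    \<Longrightarrow> x \<in> P \<longleftrightarrow> x \<otimes> l \<in> P"
  using l
proof (induction arbitrary: x rule: generate.induct)
  case one
  then show ?case by simp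
next
  case (incl s)
  have "x \<notin> boundary S P" using incl(3)[OF generate.one] incl(2) by simp
  then show ?case using incl(1,2) unfolding boundary_def by blast
next
  case (inv s)
  have s: "s \<in> carrier G" using inv(1) S by blast
  have "x \<otimes> inv s \<notin> boundary S P" using inv(3)[OF generate.inv[OF inv(1)]] .
  moreover have "(x \<otimes> inv s) \<otimes> s = x" using s inv(2) by (simp add: m_assoc)
  ultimately show ?case using inv(1,2) s unfolding boundary_def by auto
next
  case (eng h1 h2)
  have c: "h1 \<in> carrier G" "h2 \<in> carrier G"
    using eng(1,2) generate_in_carrier[OF S] by blast+
  have "(x \<otimes> h1) \<otimes> l' \<notin> boundary S P" if "l' \<in> generate G S" for l'
  proof -
    have "(x \<otimes> h1) \<otimes> l' = x \<otimes> (h1 \<otimes> l')"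
      using generate_in_carrier[OF S that] c eng(5) by (simp add: m_assoc)
    then show ?thesis using eng(6)[OF generate.eng[OF eng(1) that]] by simp
  qed
  then have "x \<otimes> h1 \<in> P \<longleftrightarrow> (x \<otimes> h1) \<otimes> h2 \<in> P"
    using eng(4)[of "x \<otimes> h1"] c eng(5) by simp
  moreover have "x \<in> P \<longleftrightarrow> x \<otimes> h1 \<in> P" using eng(3)[of x] eng(5,6) by blast
  ultimately show ?case using c eng(5) by (simp add: m_assoc)
qed

text \<open>Connectedness of the Cayley graph: as \<open>S\<close> is symmetric, a set that no edge
  leaves is entered by none, so its boundary is empty.\<close>

lemma closed_eq_carrier:
  assumes S: "S \<subseteq> carrier G" "\<And>s. s \<in> S \<Longrightarrow> inv s \<in> S" "generate G S = carrier G"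
    and Q: "Q \<subseteq> carrier G" "Q \<noteq> {}" "\<And>x s. x \<in> Q \<Longrightarrow> s \<in> S \<Longrightarrow> x \<otimes> s \<in> Q"
  shows "Q = carrier G"
proof -
  have bd: "boundary S Q = {}"
  proof -
    have "x \<in> Q" if "x \<in> carrier G" "s \<in> S" "x \<otimes> s \<in> Q" for x s
    proof -
      have "(x \<otimes> s) \<otimes> inv s = x" using that S(1) by (auto simp: m_assoc subset_iff)
      then show ?thesis using Q(3)[OF that(3) S(2)[OF that(2)]] by simp
    qed
    then show ?thesis using Q(3) unfolding boundary_def by blast
  qed
  obtain x where x: "x \<in> Q" using Q(2) by blast
  have "y \<in> Q" if y: "y \<in> carrier G" for y
  proof -
    have xc: "x \<in> carrier G" using x Q(1) by blast
    have "inv x \<otimes> y \<in> generate G S" using S(3) xc y by simp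
    from constant_off_boundary[OF S(1) this xc, of Q] bd x
    have "x \<otimes> (inv x \<otimes> y) \<in> Q" by simp
    then show ?thesis using xc y by (simp add: m_assoc[symmetric])
  qed
  then show ?thesis using Q(1) by blast
qed

section \<open>Subgroups containing the boundary of a cut\<close>

text \<open>If A meets the subgroup generated by S in a bounded set, then either a \<open>t\<close> in this subgroup
  exchanging A with its complement makes it bounded, or A avoids every coset outside L, and then
  A is disjoint from its translate by an element x outside L.\<close>

lemma cut_component:
  assumes A: "cut A"
    and S: "S \<subseteq> carrier G" "generate G S \<notin> \<B>"
    and L: "subgroup L G" "generate G S \<subseteq> L" "boundary S A \<subseteq> L"
    and H: "(\<forall>g\<in>carrier G. near (translate g A) A)
        \<or> (\<exists>t\<in>generate G S. near (translate t A) (carrier G - A))"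
    and b: "generate G S \<inter> A \<in> \<B>"
    and x: "x \<in> carrier G - L"
  shows False
  using H
proof
  assume H: "\<forall>g\<in>carrier G. near (translate g A) A"
  have AL: "A \<subseteq> L"
  proof
    fix y assume y: "y \<in> A"
    then have yc: "y \<in> carrier G" using cut_carrier[OF A] by blast
    show "y \<in> L"
    proof (rule ccontr)
      assume yL: "y \<notin> L"
      have "y \<otimes> l \<notin> boundary S A" if l: "l \<in> generate G S" for l
      proof
        assume "y \<otimes> l \<in> boundary S A"
        then have "(y \<otimes> l) \<otimes> inv l \<in> L"
          using L l by (meson subgroup.m_closed subgroup.m_inv_closed subsetD)
        moreover have "(y \<otimes> l) \<otimes> inv l = y"
          using yc generate_in_carrier[OF S(1) l] by (simp add: m_assoc)
        ultimately show False using yL by simp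
      qed
      \<comment> \<open>The coset of \<open>y\<close> lies wholly in \<open>A\<close>, so the
        translate of \<open>A\<close> by \<open>inv y\<close> contains \<open>generate G S\<close>.
        As this translate is near \<open>A\<close>, the subgroup would be bounded.\<close>
      then have "y \<otimes> l \<in> A" if "l \<in> generate G S" for l
        using constant_off_boundary[OF S(1) that yc, of A] y by blast
      then have "generate G S \<subseteq> generate G S \<inter> translate (inv y) A"
        using generate_in_carrier[OF S(1)] yc by (auto simp: translate_def)
      moreover have "near (generate G S \<inter> A) (generate G S \<inter> translate (inv y) A)"
        using H yc near_Int near_sym by simp
      ultimately show False using near_bounded b bounded_subset S(2) by blast
    qed
  qed
  have "translate x A \<inter> A = {}"
  proof (rule ccontr)
    assume "translate x A \<inter> A \<noteq> {}"
    then obtain z where z: "z \<in> A" "inv x \<otimes> z \<in> A" "z \<in> carrier G"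
      unfolding translate_def by blast
    then have "z \<otimes> inv (inv x \<otimes> z) \<in> L"
      using AL L(1) by (meson subgroup.m_closed subgroup.m_inv_closed subsetD)
    moreover have "z \<otimes> inv (inv x \<otimes> z) = x"
      using z(3) x by (simp add: inv_mult_group m_assoc[symmetric])
    ultimately show False using x by simp
  qed
  then have "A \<in> \<B>" using near_disjoint[of A "translate x A"] near_sym H x by blast
  then show False using A unfolding cut_def by blast
next
  let ?L = "generate G S"
  assume "\<exists>t\<in>?L. near (translate t A) (carrier G - A)"
  then obtain t where t: "t \<in> ?L" "near (translate t A) (carrier G - A)" by blast
  have tc: "t \<in> carrier G" using t generate_in_carrier[OF S(1)] by blast
  have sg: "subgroup ?L G" using generate_is_subgroup[OF S(1)] .
  have "?L \<inter> translate t A \<subseteq> translate t (?L \<inter> A)"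
    using sg t(1) unfolding translate_def
    by (auto intro!: subgroup.m_closed[OF sg] subgroup.m_inv_closed[OF sg])
  then have "?L \<inter> translate t A \<in> \<B>" using bounded_translate[OF tc b] bounded_subset by blast
  then have "?L \<inter> (carrier G - A) \<in> \<B>" using near_bounded near_Int t(2) by blast
  then have "(?L \<inter> A) \<union> (?L \<inter> (carrier G - A)) \<in> \<B>" using b bounded_Un by blast
  moreover have "?L \<subseteq> (?L \<inter> A) \<union> (?L \<inter> (carrier G - A))"
    using subgroup.subset[OF sg] by blast
  ultimately show False using S(2) bounded_subset by blast
qed

text \<open>For \<open>x\<close> outside \<open>L\<close> the coset of \<open>x\<close> under
  \<open>generate G S\<close> misses the boundary, hence lies on one side of the cut. Translating
  back by \<open>inv x\<close>, the subgroup meets \<open>A\<close> or its complement in a bounded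
  set, which \<open>cut_component\<close> excludes for both cuts. Keeping \<open>S\<close> and
  \<open>L\<close> apart allows \<open>L\<close> to be enlarged while the boundary stays
  fixed.\<close>

lemma cut_connected:
  assumes A: "cut A"
    and S: "S \<subseteq> carrier G" "generate G S \<notin> \<B>"
    and L: "subgroup L G" "generate G S \<subseteq> L" "boundary S A \<subseteq> L"
    and H: "(\<forall>g\<in>carrier G. near (translate g A) A)
        \<or> (\<exists>t\<in>generate G S. near (translate t A) (carrier G - A))"
  shows "L = carrier G"
proof (rule ccontr)
  assume "L \<noteq> carrier G"
  then obtain x where x: "x \<in> carrier G - L" using subgroup.subset[OF L(1)] by blast
  then have xc: "x \<in> carrier G" by blast
  let ?L = "generate G S" and ?C = "carrier G - A"
  have Lc: "?L \<subseteq> carrier G" using generate_in_carrier[OF S(1)] by blast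
  have CC: "carrier G - ?C = A" using cut_carrier[OF A] by blast
  have "x \<otimes> l \<notin> boundary S A" if l: "l \<in> ?L" for l
  proof
    assume "x \<otimes> l \<in> boundary S A"
    then have "(x \<otimes> l) \<otimes> inv l \<in> L"
      using L l by (meson subgroup.m_closed subgroup.m_inv_closed subsetD)
    moreover have "(x \<otimes> l) \<otimes> inv l = x"
      using xc generate_in_carrier[OF S(1) l] by (simp add: m_assoc)
    ultimately show False using x by simp
  qed
  then have eq: "x \<in> A \<longleftrightarrow> x \<otimes> l \<in> A" if "l \<in> ?L" for l
    using constant_off_boundary[OF S(1) that xc, of A] by blast
  have "?L \<inter> translate (inv x) A = {} \<or> ?L \<inter> translate (inv x) ?C = {}"
    using eq xc by (auto simp: translate_def)
  moreover have "near (translate (inv x) A) A \<and> near (translate (inv x) ?C) ?C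
      \<or> near (translate (inv x) A) ?C \<and> near (translate (inv x) ?C) A"
    using A xc near_compl[of "translate (inv x) A"] unfolding cut_def
    by (metis CC inv_closed translate_compl)
  ultimately have "?L \<inter> A \<in> \<B> \<or> ?L \<inter> ?C \<in> \<B>"
    using near_Int[of _ _ ?L] near_bounded bounded_empty by metis
  then show False
  proof
    assume "?L \<inter> A \<in> \<B>"
    then show False using cut_component[OF A S L H _ x] by blast
  next
    assume b: "?L \<inter> ?C \<in> \<B>"
    have "(\<forall>g\<in>carrier G. near (translate g ?C) ?C)
        \<or> (\<exists>t\<in>?L. near (translate t ?C) (carrier G - ?C))"
      using H near_compl[of "translate _ A"] translate_compl Lc by (metis subsetD)
    then show False
      using cut_component[OF cut_compl[OF A] S L(1,2) _ _ b x] L(3) boundary_compl[OF S(1)]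
      by blast
  qed
qed

section \<open>From a translation to a cyclic subgroup of bounded index\<close>

text \<open>The cover has the powers of \<open>h\<close> on the left, bounded index wants them on
  the right; inversion swaps the sides, hence the witness \<open>set_inv F\<close>. A finite
  subgroup would be bounded and make the carrier bounded.\<close>

lemma bounded_index_generate:
  assumes h: "h \<in> carrier G" and F: "F \<in> \<B>" and u: "carrier G \<notin> \<B>"
    and cover: "\<And>x. x \<in> carrier G \<Longrightarrow> \<exists>n::int. x \<in> translate (h [^] n) F"
  shows "infinite (generate G {h}) \<and> bounded_index G \<B> (generate G {h})"
proof -
  let ?H = "generate G {h}"
  have H: "?H = {h [^] (k::int) | k. k \<in> UNIV}" using generate_pow[OF h] .
  have Hc: "?H \<subseteq> carrier G" using H h by auto
  have eq: "set_inv F <#> ?H = carrier G"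
  proof
    show "set_inv F <#> ?H \<subseteq> carrier G"
      using set_mult_closed[OF bounded_carrier[OF bounded_inv[OF F]] Hc] .
    show "carrier G \<subseteq> set_inv F <#> ?H"
    proof
      fix x assume x: "x \<in> carrier G"
      then obtain n :: int where n: "inv (h [^] n) \<otimes> inv x \<in> F"
        using cover[of "inv x"] unfolding translate_def by auto
      have "inv (inv (h [^] n) \<otimes> inv x) \<otimes> inv (h [^] n) = x"
        using x h by (simp add: inv_mult_group m_assoc)
      moreover have "inv (h [^] n) \<in> ?H" using H h by (auto simp: int_pow_neg[symmetric])
      ultimately show "x \<in> set_inv F <#> ?H" using mem_set_mult mem_set_inv n by metis
    qed
  qed
  have "?H \<notin> \<B>" using eq u bounded_mult bounded_inv F by metis
  then have "infinite ?H" using bounded_finite Hc by blast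
  then show ?thesis unfolding bounded_index_def using eq F bounded_inv by blast
qed

text \<open>The translates \<open>T n\<close> decrease, and the boundary of \<open>T n\<close> lies
  in a translate of \<open>D\<close> that is inside \<open>T (n - 1)\<close> and misses
  \<open>T (n + 1)\<close>. Hence no edge leaves the union or the intersection of all
  \<open>T n\<close>; by connectedness the union is everything and the intersection is empty, so
  each \<open>x\<close> has a last \<open>n\<close> with \<open>x\<close> in
  \<open>T n\<close>.\<close>

lemma translation_exhausts:
  assumes S: "S \<subseteq> carrier G" "\<And>s. s \<in> S \<Longrightarrow> inv s \<in> S" "generate G S = carrier G"
    and A: "A \<subseteq> carrier G" "A \<noteq> {}" "A \<noteq> carrier G" "boundary S A \<subseteq> D"
    and h: "h \<in> carrier G" "translate h A \<subseteq> A" "translate h D \<subseteq> A" "D \<inter> translate h A = {}"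
    and x: "x \<in> carrier G"
  shows "\<exists>n::int. x \<in> translate (h [^] n) (A - translate h A)"
proof -
  define T where "T n = translate (h [^] (n::int)) A" for n
  have suc: "translate (h [^] n) (translate h X) = translate (h [^] (n + 1)) X" for n :: int and X
    using h(1) by (simp add: translate_translate int_pow_mult)
  have dec: "T (n + 1) \<subseteq> T n" for n
    using translate_mono[OF h(2), of "h [^] n"] suc unfolding T_def by simp
  have bd: "boundary S (T n) \<subseteq> translate (h [^] n) D" for n
    using boundary_translate[OF _ S(1), of "h [^] n" A] h(1) translate_mono[OF A(4)]
    unfolding T_def by simp
  have out: "translate (h [^] n) D \<inter> T (n + 1) = {}" for n
    using translate_Int[of "h [^] n" D "translate h A"] h(4) suc[of n A] translate_empty
    unfolding T_def by simp
  have into: "translate (h [^] n) D \<subseteq> T (n - 1)" for n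
    using translate_mono[OF h(3), of "h [^] (n - 1)"] suc[of "n - 1" D] unfolding T_def by simp
  have T0: "T 0 = A" unfolding T_def using A(1) by (simp add: translate_one)
  have Tc: "T n \<subseteq> carrier G" for n unfolding T_def by (rule translate_carrier)
  have "(\<Inter>n. T n) = {}"
  proof (rule ccontr)
    assume ne: "(\<Inter>n. T n) \<noteq> {}"
    have "y \<otimes> s \<in> (\<Inter>n. T n)" if y: "y \<in> (\<Inter>n. T n)" and s: "s \<in> S" for y s
    proof (rule ccontr)
      assume "y \<otimes> s \<notin> (\<Inter>n. T n)"
      then obtain k where "y \<otimes> s \<notin> T k" by blast
      then have "y \<in> boundary S (T k)" using y s Tc unfolding boundary_def by blast
      then show False using bd out[of k] y by blast
    qed
    moreover have "(\<Inter>n. T n) \<subseteq> carrier G" using Tc[of 0] by blast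
    ultimately have "(\<Inter>n. T n) = carrier G" using closed_eq_carrier[OF S _ ne] by simp
    then show False using T0 A(1,3) by blast
  qed
  then obtain k where k: "x \<notin> T k" by blast
  have "(\<Union>n. T n) = carrier G"
  proof (rule closed_eq_carrier[OF S])
    show "(\<Union>n. T n) \<subseteq> carrier G" "(\<Union>n. T n) \<noteq> {}" using Tc T0 A(2) by blast+
    fix y s assume "y \<in> (\<Union>n. T n)" and s: "s \<in> S"
    then obtain n where n: "y \<in> T n" by blast
    have c: "y \<in> carrier G" "s \<in> carrier G" using n Tc s S(1) by blast+
    show "y \<otimes> s \<in> (\<Union>n. T n)"
    proof (cases "y \<otimes> s \<in> T n")
      case False
      have "(y \<otimes> s) \<otimes> inv s = y" using c by (simp add: m_assoc)
      then have "y \<otimes> s \<in> boundary S (T n)"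
        using False n c S(2)[OF s] unfolding boundary_def by (auto intro!: bexI[of _ "inv s"])
      then show ?thesis using bd into by blast
    qed blast
  qed
  then obtain m where m: "x \<in> T m" using x by blast
  have "\<exists>n. x \<in> T n \<and> x \<notin> T (n + 1)"
  proof (rule ccontr)
    assume no: "\<nexists>n. x \<in> T n \<and> x \<notin> T (n + 1)"
    \<comment> \<open>From \<open>m\<close>, membership spreads upwards by \<open>no\<close> and
      downwards because the sets decrease.\<close>
    have "x \<in> T i" for i
    proof (induction i rule: int_induct[where k = m])
      case (step2 i)
      then show ?case using dec[of "i - 1"] by auto
    qed (use m no in auto)
    then show False using k by blast
  qed
  then obtain n where n: "x \<in> T n" "x \<notin> T (n + 1)" by blast
  have "translate (h [^] n) (A - translate h A) = T n - T (n + 1)"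
    by (simp add: translate_Diff suc T_def)
  then show ?thesis using n by blast
qed

section \<open>Nested translates of a cut\<close>

text \<open>A common point lies in neither boundary, so every edge from it stays in both sets; a
  nonempty intersection would be the whole group.\<close>

lemma disjoint_of_boundaries:
  assumes S: "S \<subseteq> carrier G" "\<And>s. s \<in> S \<Longrightarrow> inv s \<in> S" "generate G S = carrier G"
    and "X \<subset> carrier G" "boundary S X \<inter> Y = {}" "boundary S Y \<inter> X = {}"
  shows "X \<inter> Y = {}"
proof (rule ccontr)
  assume "X \<inter> Y \<noteq> {}"
  moreover have "x \<otimes> s \<in> X \<inter> Y" if "x \<in> X \<inter> Y" "s \<in> S" for x s
    using that assms(4-6) unfolding boundary_def by blast
  ultimately have "X \<inter> Y = carrier G"
    using closed_eq_carrier[OF S, of "X \<inter> Y"] assms(4) by blast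
  then show False using assms(4) by blast
qed

text \<open>Connectedness puts \<open>D\<close> on one side of the translated cut and the translate
  of \<open>D\<close> on one side of \<open>A\<close>. Each of the four combinations empties one of
  the four intersections of sides. Two give a nested pair; the other two would make two sets that
  are near each other disjoint, hence bounded.\<close>

lemma cut_translation:
  assumes S: "S \<subseteq> carrier G" "\<And>s. s \<in> S \<Longrightarrow> inv s \<in> S" "generate G S = carrier G"
    and A: "cut A" "boundary S A \<subseteq> D"
    and D: "D \<in> \<B>" "\<And>P. boundary S P \<inter> D = {} \<Longrightarrow> D \<subseteq> P \<or> D \<inter> P = {}"
  shows "\<exists>h\<in>carrier G. near (translate h A) A \<and> translate h A \<subseteq> A
     \<and> translate h D \<subseteq> A \<and> D \<inter> translate h A = {}"
proof -
  let ?C = "carrier G - A"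
  have Ac: "A \<subseteq> carrier G" using cut_carrier[OF A(1)] .
  have CC: "carrier G - ?C = A" using Ac by blast
  have Dc: "D \<subseteq> carrier G" using D(1) by (rule bounded_carrier)
  have uA: "A \<notin> \<B>" "?C \<notin> \<B>" using A(1) unfolding cut_def by auto
  \<comment> \<open>If \<open>translate g D\<close> meets \<open>D\<close> in \<open>d\<close>, then
    \<open>g\<close> is the product of \<open>d\<close> and the inverse of
    \<open>inv g \<otimes> d\<close>, so it lies in \<open>W\<close>.\<close>
  define W where "W = D <#> set_inv D"
  have W: "W \<in> \<B>" unfolding W_def using D(1) bounded_inv bounded_mult by blast
  have ucar: "carrier G \<notin> \<B>" using uA(1) Ac bounded_subset by blast
  have "\<exists>g\<in>carrier G. g \<notin> W \<and> near (translate g A) A"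
  proof (rule ccontr)
    assume no: "\<not> (\<exists>g\<in>carrier G. g \<notin> W \<and> near (translate g A) A)"
    then have C: "near (translate g A) ?C" if "g \<in> carrier G" "g \<notin> W" for g
      using that A(1) unfolding cut_def by blast
    \<comment> \<open>If all elements outside \<open>W\<close> exchange the sides, then for
      \<open>g\<close> outside \<open>W\<close> the product \<open>t \<otimes> g\<close> exchanges
      them twice, hence preserves \<open>A\<close> and lies in \<open>W\<close>. So the carrier
      would be a union of two bounded sets.\<close>
    obtain t where t: "t \<in> carrier G" "t \<notin> W"
      using ucar W bounded_subset by blast
    have "g \<in> W \<union> translate (inv t) W" if g: "g \<in> carrier G" for g
    proof (rule ccontr)
      assume n: "g \<notin> W \<union> translate (inv t) W"
      have "near (translate (t \<otimes> g) A) (carrier G - translate t A)"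
        using near_translate[OF t(1) C[OF g]] n t(1) g
        by (simp add: translate_translate translate_compl)
      moreover have "near (carrier G - translate t A) A"
        using near_compl[OF C[OF t]] CC by simp
      ultimately have "t \<otimes> g \<in> W" using no t(1) g near_trans by blast
      then show False using n g t(1) unfolding translate_def by simp
    qed
    then have "carrier G \<subseteq> W \<union> translate (inv t) W" by blast
    then show False
      using ucar W t(1) bounded_Un bounded_translate bounded_subset inv_closed by metis
  qed
  then obtain g where g: "g \<in> carrier G" "g \<notin> W" "near (translate g A) A" by blast
  let ?gA = "translate g A" and ?gC = "translate g ?C" and ?gD = "translate g D"
  have gC: "?gC = carrier G - ?gA" using translate_compl g(1) by blast
  have gAc: "?gA \<subseteq> carrier G" by (rule translate_carrier)
  have bg: "boundary S ?gA \<subseteq> ?gD"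
    using boundary_translate[OF g(1) S(1)] translate_mono[OF A(2)] by simp
  have disj: "?gD \<inter> D = {}"
  proof (rule ccontr)
    assume "?gD \<inter> D \<noteq> {}"
    then obtain d where d: "d \<in> D" "inv g \<otimes> d \<in> D" "d \<in> carrier G"
      unfolding translate_def by blast
    have "d \<otimes> inv (inv g \<otimes> d) = g"
      using d(3) g(1) by (simp add: inv_mult_group m_assoc[symmetric])
    then show False using d g(2) mem_set_mult mem_set_inv unfolding W_def by metis
  qed
  have D1: "D \<subseteq> ?gA \<or> D \<inter> ?gA = {}" using D(2)[of ?gA] bg disj by blast
  \<comment> \<open>The connectedness of \<open>D\<close> is applied to the translate of
    \<open>A\<close> by \<open>inv g\<close>, and the outcome is moved by \<open>g\<close>.\<close>
  have D2: "?gD \<subseteq> A \<or> ?gD \<inter> A = {}"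
  proof -
    have "boundary S (translate (inv g) A) \<inter> D
        \<subseteq> translate (inv g) D \<inter> translate (inv g) ?gD"
      using boundary_translate[OF inv_closed[OF g(1)] S(1), of A] translate_mono[OF A(2)]
        translate_inv_cancel[OF g(1) Dc] by auto
    also have "\<dots> = {}" using disj translate_Int[of "inv g" D ?gD] translate_empty
      by (simp add: Int_commute)
    finally have "D \<subseteq> translate (inv g) A \<or> D \<inter> translate (inv g) A = {}" using D(2) by blast
    then show ?thesis
      using translate_mono[of D "translate (inv g) A" g] translate_cancel_inv[OF g(1) Ac]
        translate_Int[of g D "translate (inv g) A"] translate_empty by auto
  qed
  have gCA: "near ?gC ?C" using near_compl[OF g(3)] gC by simp
  have proper: "X \<subset> carrier G" if "X \<subseteq> carrier G" "carrier G - X \<notin> \<B>" for X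
    using that bounded_empty by auto
  have pA: "A \<subset> carrier G" "?C \<subset> carrier G" using proper Ac uA CC by auto
  have bC: "boundary S ?C = boundary S A" "boundary S ?gC = boundary S ?gA"
    using boundary_compl[OF S(1)] gC by auto
  have nest: "X \<inter> Y = {}"
    if "X \<subset> carrier G" "boundary S X \<inter> Y = {}" "boundary S Y \<inter> X = {}" for X Y
    using disjoint_of_boundaries[OF S] that by blast
  consider "D \<inter> ?gA = {}" "?gD \<subseteq> A" | "D \<subseteq> ?gA" "?gD \<inter> A = {}"
    | "D \<subseteq> ?gA" "?gD \<subseteq> A" | "D \<inter> ?gA = {}" "?gD \<inter> A = {}"
    using D1 D2 by blast
  then show ?thesis
  proof cases
    case 1
    have "boundary S ?C \<inter> ?gA = {}" "boundary S ?gA \<inter> ?C = {}"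
      unfolding bC using 1 A(2) bg by blast+
    then have "?C \<inter> ?gA = {}" by (rule nest[OF pA(2)])
    then have "?gA \<subseteq> A" using gAc by blast
    then show ?thesis using 1 g by blast
  next
    case 2
    have "boundary S A \<inter> ?gC = {}" "boundary S ?gC \<inter> A = {}"
      unfolding bC unfolding gC using 2 A(2) bg by blast+
    then have "A \<inter> ?gC = {}" by (rule nest[OF pA(1)])
    then have sub: "A \<subseteq> ?gA" using gC Ac by blast
    \<comment> \<open>Here \<open>g\<close> expands \<open>A\<close>, so its inverse is the
      contracting element.\<close>
    let ?h = "inv g"
    have h: "?h \<in> carrier G" using g(1) by simp
    have "near (translate ?h A) A"
      using near_sym[OF near_translate[OF h g(3)]] translate_inv_cancel[OF g(1) Ac] by simp
    moreover have "translate ?h A \<subseteq> A"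
      using translate_mono[OF sub, of ?h] translate_inv_cancel[OF g(1) Ac] by simp
    moreover have "translate ?h D \<subseteq> A"
      using translate_mono[OF 2(1), of ?h] translate_inv_cancel[OF g(1) Ac] by simp
    moreover have "D \<inter> translate ?h A = {}"
      using translate_Int[of ?h ?gD A] 2(2) translate_empty translate_inv_cancel[OF g(1) Dc]
      by simp
    ultimately show ?thesis using h by blast
  next
    case 3
    have "boundary S ?C \<inter> ?gC = {}" "boundary S ?gC \<inter> ?C = {}"
      unfolding bC unfolding gC using 3 A(2) bg by blast+
    then have "?C \<inter> ?gC = {}" by (rule nest[OF pA(2)])
    then have "?C \<in> \<B>" using near_disjoint[OF near_sym[OF gCA]] by simp
    then show ?thesis using uA by simp
  next
    case 4
    have "boundary S A \<inter> ?gA = {}" "boundary S ?gA \<inter> A = {}" using 4 A(2) bg by blast+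
    then have "A \<inter> ?gA = {}" by (rule nest[OF pA(1)])
    then have "A \<in> \<B>" using near_disjoint[OF near_sym[OF g(3)]] by simp
    then show ?thesis using uA by simp
  qed
qed

section \<open>Balls and bounded generating sets\<close>

text \<open>Products of exactly \<open>n\<close> factors; they are the increasing balls of the word
  metric once \<open>S\<close> is symmetric and contains \<open>\<one>\<close>.\<close>

primrec ball :: "'a set \<Rightarrow> nat \<Rightarrow> 'a set" where
  "ball S 0 = {\<one>}"
| "ball S (Suc n) = ball S n <#> S"

lemma bounded_ball: "S \<in> \<B> \<Longrightarrow> ball S n \<in> \<B>"
  by (induction n) (auto intro: bounded_mult bounded_singleton)

lemma ball_Suc_mono:
  assumes "S \<in> \<B>" "\<one> \<in> S"
  shows "ball S n \<subseteq> ball S (Suc n)"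
proof
  fix x assume x: "x \<in> ball S n"
  then have "x \<otimes> \<one> = x" using bounded_carrier[OF bounded_ball[OF assms(1)], of n] by auto
  then show "x \<in> ball S (Suc n)" using x assms(2) mem_set_mult by (metis ball.simps(2))
qed

lemma ball_mono:
  assumes "S \<in> \<B>" "\<one> \<in> S" "m \<le> n"
  shows "ball S m \<subseteq> ball S n"
  using lift_Suc_mono_le[of "ball S", OF ball_Suc_mono[OF assms(1,2)] assms(3)] .

lemma Union_ball:
  assumes "S \<in> \<B>" "\<And>s. s \<in> S \<Longrightarrow> inv s \<in> S" "generate G S = carrier G"
  shows "(\<Union>n. ball S n) = carrier G"
proof (rule closed_eq_carrier[OF bounded_carrier[OF assms(1)] assms(2,3)])
  show "(\<Union>n. ball S n) \<subseteq> carrier G" using bounded_carrier bounded_ball assms(1) by blast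
  show "(\<Union>n. ball S n) \<noteq> {}" using ball.simps(1) by blast
  fix x s assume "x \<in> (\<Union>n. ball S n)" and s: "s \<in> S"
  then obtain n where "x \<in> ball S n" by blast
  then have "x \<otimes> s \<in> ball S (Suc n)" using mem_set_mult s by simp
  then show "x \<otimes> s \<in> (\<Union>n. ball S n)" by blast
qed

text \<open>Each point is joined to \<open>\<one>\<close> by a path through smaller balls, all
  inside \<open>ball S n\<close>, where no edge crosses.\<close>

lemma ball_connected:
  assumes "S \<in> \<B>" "\<one> \<in> S" "boundary S P \<inter> ball S n = {}"
  shows "ball S n \<subseteq> P \<or> ball S n \<inter> P = {}"
proof -
  have "\<forall>x\<in>ball S m. x \<in> P \<longleftrightarrow> \<one> \<in> P" if "m \<le> n" for m
    using that
  proof (induction m)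
    case (Suc m)
    show ?case
    proof
      fix x assume "x \<in> ball S (Suc m)"
      then obtain y s where y: "y \<in> ball S m" "s \<in> S" "x = y \<otimes> s" by (auto elim: set_multE)
      have "y \<in> ball S n" using y(1) ball_mono[OF assms(1,2), of m n] Suc(2) by auto
      then have "y \<notin> boundary S P" "y \<in> carrier G"
        using assms(3) bounded_carrier[OF bounded_ball[OF assms(1)]] by blast+
      then have "y \<in> P \<longleftrightarrow> x \<in> P" using y unfolding boundary_def by blast
      then show "x \<in> P \<longleftrightarrow> \<one> \<in> P" using Suc y(1) by simp
    qed
  qed simp
  then show ?thesis by blast
qed

text \<open>Bounded geometry is used twice. The centres covering \<open>boundary S A\<close> are
  adjoined as generators, which makes \<open>S'\<close> generate the group. The boundary for the
  larger \<open>S'\<close> is a new set with new centres, but these are now words in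
  \<open>S'\<close> of bounded length.\<close>

lemma bounded_symmetric_generators:
  assumes bg: "bounded_geometry G \<B>" and nl: "\<not> locally_bounded G \<B>" and A: "cut A"
  shows "\<exists>S D. S \<in> \<B> \<and> (\<forall>s\<in>S. inv s \<in> S) \<and> generate G S = carrier G \<and> D \<in> \<B>
     \<and> boundary S A \<subseteq> D \<and> (\<forall>P. boundary S P \<inter> D = {} \<longrightarrow> D \<subseteq> P \<or> D \<inter> P = {})"
proof -
  obtain K where K: "K \<in> \<B>"
    "\<And>B. B \<in> \<B> \<Longrightarrow> \<exists>F. finite F \<and> F \<subseteq> carrier G \<and> B \<subseteq> (\<Union>g\<in>F. g <# K)"
    using bg unfolding bounded_geometry_def by blast
  obtain B where B: "B \<in> \<B>" "generate G B \<notin> \<B>" using nl unfolding locally_bounded_def by blast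
  \<comment> \<open>If some translation exchanges the sides, \<open>t\<close> is one that does;
    otherwise any \<open>t\<close>, such as \<open>\<one>\<close>, will do.\<close>
  obtain t where t: "t \<in> carrier G"
    "(\<forall>g\<in>carrier G. near (translate g A) A) \<or> near (translate t A) (carrier G - A)"
    using A one_closed unfolding cut_def by metis
  define sym where "sym X = X \<union> set_inv X" for X
  have symb: "sym X \<in> \<B>" if "X \<in> \<B>" for X
    unfolding sym_def using that bounded_Un bounded_inv by blast
  have symi: "inv s \<in> sym X" if "X \<in> \<B>" "s \<in> sym X" for s X
    using that bounded_carrier[of X] unfolding sym_def SET_INV_def by auto
  \<comment> \<open>\<open>B\<close> makes the generated subgroup unbounded, \<open>t\<close> puts
    an exchanging element into it if there is one, and \<open>K\<close> absorbs the cosets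
    \<open>g <# K\<close>.\<close>
  define S where "S = K \<union> B \<union> {t}"
  have S: "S \<in> \<B>" unfolding S_def using K(1) B(1) t(1) by (intro bounded_Un bounded_singleton)
  have Sc: "S \<subseteq> carrier G" using S by (rule bounded_carrier)
  have clA: "coarsely_clopen G \<B> A" using A unfolding cut_def by blast
  obtain F where F: "finite F" "F \<subseteq> carrier G" "boundary S A \<subseteq> (\<Union>g\<in>F. g <# K)"
    using K(2)[OF bounded_boundary[OF clA S]] by blast
  \<comment> \<open>With \<open>F\<close> and \<open>K\<close> inside, the generated subgroup
    contains \<open>boundary S A\<close>; \<open>\<one>\<close> makes the balls increase.\<close>
  define S' where "S' = sym (S \<union> F \<union> {\<one>})"
  have b: "S \<union> F \<union> {\<one>} \<in> \<B>"
    using S bounded_finite[OF F(1,2)] bounded_singleton[OF one_closed] by (intro bounded_Un)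
  have S': "S' \<in> \<B>" unfolding S'_def using symb b by blast
  have inv: "inv s \<in> S'" if "s \<in> S'" for s using that symi b unfolding S'_def by blast
  have S'c: "S' \<subseteq> carrier G" using S' by (rule bounded_carrier)
  have incl: "S \<subseteq> S'" "F \<subseteq> S'" "\<one> \<in> S'" "K \<subseteq> S'" unfolding S'_def sym_def S_def by blast+
  have gen: "generate G S' = carrier G"
  proof (rule cut_connected[OF A Sc])
    show "generate G S \<notin> \<B>"
      using B(2) mono_generate[of B S] bounded_subset unfolding S_def by blast
    show "subgroup (generate G S') G" using generate_is_subgroup[OF S'c] .
    show "generate G S \<subseteq> generate G S'" using mono_generate[OF incl(1)] .
    have "g <# K \<subseteq> generate G S'" if "g \<in> F" for g
      using that incl generate.incl[of _ S' G] generate.eng[of g G S'] unfolding l_coset_def by blast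
    then show "boundary S A \<subseteq> generate G S'" using F(3) by blast
    show "(\<forall>g\<in>carrier G. near (translate g A) A)
        \<or> (\<exists>t\<in>generate G S. near (translate t A) (carrier G - A))"
      using t(2) generate.incl[of t S G] unfolding S_def by blast
  qed
  obtain F' where F': "finite F'" "F' \<subseteq> carrier G" "boundary S' A \<subseteq> (\<Union>g\<in>F'. g <# K)"
    using K(2)[OF bounded_boundary[OF clA S']] by blast
  have "\<forall>g\<in>F'. \<exists>n. g \<in> ball S' n" using Union_ball[OF S' inv gen] F'(2) by blast
  then obtain r where r: "\<And>g. g \<in> F' \<Longrightarrow> g \<in> ball S' (r g)" by metis
  \<comment> \<open>The sum bounds every radius \<open>r g\<close>, also when \<open>F'\<close> is
    empty; the extra step is the factor from \<open>K\<close>.\<close>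
  define N where "N = Suc (\<Sum>g\<in>F'. r g)"
  have "g <# K \<subseteq> ball S' N" if g: "g \<in> F'" for g
  proof
    fix x assume "x \<in> g <# K"
    then obtain k where k: "k \<in> K" "x = g \<otimes> k" unfolding l_coset_def by blast
    have "r g \<le> (\<Sum>g\<in>F'. r g)" using g F'(1) by (simp add: member_le_sum)
    then have "g \<in> ball S' (\<Sum>g\<in>F'. r g)"
      using r[OF g] ball_mono[OF S' incl(3)] by blast
    then show "x \<in> ball S' N" using k incl(4) mem_set_mult unfolding N_def by auto
  qed
  then have "boundary S' A \<subseteq> ball S' N" using F'(3) by blast
  then show ?thesis
    using S' inv gen bounded_ball[OF S'] ball_connected[OF S' incl(3)] by blast
qed

lemma two_ends_cyclic:
  assumes bg: "bounded_geometry G \<B>" and nl: "\<not> locally_bounded G \<B>"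
    and two: "card (ends G \<B>) = 2"
  shows "\<exists>h\<in>carrier G. infinite (generate G {h}) \<and> bounded_index G \<B> (generate G {h})"
proof -
  obtain A where A: "cut A" using ex_cut[OF two] by blast
  obtain S D where S: "S \<in> \<B>" "\<And>s. s \<in> S \<Longrightarrow> inv s \<in> S" "generate G S = carrier G"
    and D: "D \<in> \<B>" "boundary S A \<subseteq> D" "\<And>P. boundary S P \<inter> D = {} \<Longrightarrow> D \<subseteq> P \<or> D \<inter> P = {}"
    using bounded_symmetric_generators[OF bg nl A] by blast
  note S' = bounded_carrier[OF S(1)] S(2,3)
  obtain h where h: "h \<in> carrier G" "near (translate h A) A" "translate h A \<subseteq> A"
    "translate h D \<subseteq> A" "D \<inter> translate h A = {}"
    using cut_translation[OF S' A D(2,1,3)] by blast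
  have Ac: "A \<subseteq> carrier G" using cut_carrier[OF A] .
  have u: "A \<notin> \<B>" "carrier G - A \<notin> \<B>" using A unfolding cut_def by auto
  have ne: "A \<noteq> {}" "A \<noteq> carrier G" using u bounded_empty by auto
  \<comment> \<open>Inclusion alone would not do: nearness is what bounds the set whose translates
    cover the group.\<close>
  have "A - translate h A \<in> \<B>" using h(2) bounded_subset unfolding near_def by blast
  moreover have "carrier G \<notin> \<B>" using u(1) Ac bounded_subset by blast
  ultimately have "infinite (generate G {h}) \<and> bounded_index G \<B> (generate G {h})"
    using bounded_index_generate[OF h(1)] translation_exhausts[OF S' Ac ne D(2) h(1,3,4,5)]
    by blast
  then show ?thesis using h(1) by blast
qed

end

theorem theorem9p13:
  fixes G :: "('a, 'b) monoid_scheme" and \<B> :: "'a set set"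
  assumes "large_scale_group G \<B>"
    and "bounded_geometry G \<B>"
    and "\<not> locally_bounded G \<B>"
    and "sigma_bounded G \<B>"
    and "card (ends G \<B>) = 2"
  shows "\<exists>h\<in>carrier G. infinite (generate G {h}) \<and> bounded_index G \<B> (generate G {h})"
proof -
  have "group G" using assms(1) unfolding large_scale_group_def by blast
  then interpret ls_group G \<B> using assms(1) by (simp add: ls_group_def ls_group_axioms_def)
  show ?thesis using two_ends_cyclic assms by blast
qed

end
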